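(* Let $A$ be a semisimple, topologically singly generated operator algebra whose socle has a bounded approximate identity. Then $A$ has a dense socle if and only if $A$ is compact.
   Context: An operator algebra is a norm closed (not necessarily unital) subalgebra of $B(H)$ for a Hilbert space $H$. It is topologically singly generated if it is the smallest norm closed subalgebra containing some single element; such an algebra is commutative. A commutative Banach algebra $A$ is called compact if for every $a\in A$ the operator $b\mapsto ab$ on $A$ is compact. The socle of the commutative semisimple algebra $A$ is the linear span of its minimal idempotents, i.e. of the nonzero idempotents $e\in A$ with $eA=\mathbb C e$. *)

theory Defs
  imports "HOL-Analysis.Analysis"
begin

section \<open>Complex Hilbert spaces\<close>

text \<open>The complex scalar multiplication extends the given real one; \<open>1 *\<^sub>C x = x\<close> follows.\<close>

class complex_normed_vector = real_normed_vector +
  fixes scaleC :: "complex \<Rightarrow> 'a \<Rightarrow> 'a" (infixr "*\<^sub>C" 75)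
  assumes scaleC_add_right: "c *\<^sub>C (x + y) = c *\<^sub>C x + c *\<^sub>C y"
    and scaleC_add_left: "(c + d) *\<^sub>C x = c *\<^sub>C x + d *\<^sub>C x"
    and scaleC_scaleC: "c *\<^sub>C d *\<^sub>C x = (c * d) *\<^sub>C x"
    and scaleC_of_real: "complex_of_real r *\<^sub>C x = r *\<^sub>R x"
    and norm_scaleC: "norm (c *\<^sub>C x) = cmod c * norm x"

global_interpretation complex_vector:
  vector_space "scaleC :: complex \<Rightarrow> 'a \<Rightarrow> 'a::complex_normed_vector"
proof
  show "1 *\<^sub>C x = x" for x :: 'a
    using scaleC_of_real[of 1 x] by simp
qed (simp_all add: scaleC_add_right scaleC_add_left scaleC_scaleC)

text \<open>Inner products are linear in the first variable.  In the presence of the other axioms the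
  norm axioms inherited from the superclass are redundant (Cauchy--Schwarz).\<close>

class complex_inner = complex_normed_vector +
  fixes cinner :: "'a \<Rightarrow> 'a \<Rightarrow> complex"
  assumes cinner_commute: "cinner y x = cnj (cinner x y)"
    and cinner_add_left: "cinner (x + y) z = cinner x z + cinner y z"
    and cinner_scaleC_left: "cinner (c *\<^sub>C x) y = c * cinner x y"
    and cinner_self: "cinner x x = complex_of_real ((norm x)\<^sup>2)"

class complex_hilbert_space = complex_inner + complete_space

instantiation complex :: complex_hilbert_space
begin

definition scaleC_complex :: "complex \<Rightarrow> complex \<Rightarrow> complex"
  where "scaleC_complex c x = c * x"

definition cinner_complex :: "complex \<Rightarrow> complex \<Rightarrow> complex"
  where "cinner_complex x y = x * cnj y"

instance
  by standard
    (simp_all add: scaleC_complex_def cinner_complex_def algebra_simps scaleR_conv_of_real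
      norm_mult complex_norm_square del: of_real_power)

end

section \<open>Bounded operators\<close>

text \<open>The type \<open>'h \<Rightarrow>\<^sub>L 'h\<close> consists of the bounded \<^emph>\<open>real\<close>-linear operators; \<open>B(H)\<close> is its
  subset of complex-linear ones, with the same operator norm.\<close>

instantiation blinfun :: (real_normed_vector, complex_normed_vector) complex_normed_vector
begin

lift_definition scaleC_blinfun :: "complex \<Rightarrow> 'a \<Rightarrow>\<^sub>L 'b \<Rightarrow> 'a \<Rightarrow>\<^sub>L 'b"
  is "\<lambda>c f x. c *\<^sub>C f x"
proof -
  fix c :: complex and f :: "'a \<Rightarrow> 'b"
  assume "bounded_linear f"
  then interpret f: bounded_linear f .
  show "bounded_linear (\<lambda>x. c *\<^sub>C f x)"
  proof (rule bounded_linear_intro)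
    show "c *\<^sub>C f (x + y) = c *\<^sub>C f x + c *\<^sub>C f y" for x y
      by (simp add: f.add scaleC_add_right)
    show "c *\<^sub>C f (r *\<^sub>R x) = r *\<^sub>R c *\<^sub>C f x" for r x
      by (simp add: f.scaleR scaleC_scaleC mult.commute flip: scaleC_of_real)
    show "norm (c *\<^sub>C f x) \<le> norm x * (cmod c * onorm f)" for x
      using mult_left_mono[OF onorm[OF f.bounded_linear, of x], of "cmod c"]
      by (simp add: norm_scaleC mult_ac)
  qed
qed

instance
proof
  fix c d :: complex and r :: real and f g :: "'a \<Rightarrow>\<^sub>L 'b"
  show "c *\<^sub>C (f + g) = c *\<^sub>C f + c *\<^sub>C g"
    by transfer (simp add: scaleC_add_right)
  show "(c + d) *\<^sub>C f = c *\<^sub>C f + d *\<^sub>C f"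
    by transfer (simp add: scaleC_add_left)
  show scale: "c *\<^sub>C d *\<^sub>C f = (c * d) *\<^sub>C f" for c d and f :: "'a \<Rightarrow>\<^sub>L 'b"
    by transfer (simp add: scaleC_scaleC)
  show of_real: "complex_of_real r *\<^sub>C f = r *\<^sub>R f" for r and f :: "'a \<Rightarrow>\<^sub>L 'b"
    by transfer (simp add: scaleC_of_real)
  have le: "norm (c *\<^sub>C f) \<le> cmod c * norm f" for c and f :: "'a \<Rightarrow>\<^sub>L 'b"
  proof (rule norm_blinfun_bound)
    show "norm (blinfun_apply (c *\<^sub>C f) x) \<le> cmod c * norm f * norm x" for x
      using mult_left_mono[OF norm_blinfun[of f x], of "cmod c"]
      by (simp add: scaleC_blinfun.rep_eq norm_scaleC mult_ac)
  qed simp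
  show "norm (c *\<^sub>C f) = cmod c * norm f"
  proof (cases "c = 0")
    case True
    then show ?thesis using of_real[of 0 f] by simp
  next
    case False
    have "f = inverse c *\<^sub>C c *\<^sub>C f"
      using of_real[of 1 f] False by (simp add: scale)
    then have "norm f \<le> inverse (cmod c) * norm (c *\<^sub>C f)"
      using le[of "inverse c" "c *\<^sub>C f"] by (simp add: norm_inverse)
    then have "cmod c * norm f \<le> norm (c *\<^sub>C f)"
      using False by (simp add: field_simps)
    with le[of c f] show ?thesis by simp
  qed
qed

end

definition bounded_operators :: "('h::complex_hilbert_space \<Rightarrow>\<^sub>L 'h) set"
  where "bounded_operators =
    {T. \<forall>c x. blinfun_apply T (c *\<^sub>C x) = c *\<^sub>C blinfun_apply T x}"

section \<open>Operator algebras\<close>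

definition operator_algebra :: "('h::complex_hilbert_space \<Rightarrow>\<^sub>L 'h) set \<Rightarrow> bool"
  where "operator_algebra A \<longleftrightarrow>
    A \<subseteq> bounded_operators \<and> complex_vector.subspace A \<and>
    (\<forall>a\<in>A. \<forall>b\<in>A. (a o\<^sub>L b) \<in> A) \<and> closed A"

definition topologically_singly_generated :: "('h::complex_hilbert_space \<Rightarrow>\<^sub>L 'h) set \<Rightarrow> bool"
  where "topologically_singly_generated A \<longleftrightarrow>
    (\<exists>x\<in>A. A = \<Inter>{B. operator_algebra B \<and> x \<in> B})"

text \<open>\<open>A\<close> need not be unital, so the Jacobson radical is the intersection of the maximal
  \<^emph>\<open>modular\<close> left ideals; it is all of \<open>A\<close> if there are none.\<close>

definition left_ideal ::
    "('h::complex_hilbert_space \<Rightarrow>\<^sub>L 'h) set \<Rightarrow> ('h \<Rightarrow>\<^sub>L 'h) set \<Rightarrow> bool"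
  where "left_ideal A I \<longleftrightarrow>
    I \<subseteq> A \<and> complex_vector.subspace I \<and> (\<forall>a\<in>A. \<forall>b\<in>I. (a o\<^sub>L b) \<in> I)"

definition maximal_modular_left_ideal ::
    "('h::complex_hilbert_space \<Rightarrow>\<^sub>L 'h) set \<Rightarrow> ('h \<Rightarrow>\<^sub>L 'h) set \<Rightarrow> bool"
  where "maximal_modular_left_ideal A I \<longleftrightarrow>
    left_ideal A I \<and> I \<noteq> A \<and>
    (\<exists>u\<in>A. \<forall>a\<in>A. a - (a o\<^sub>L u) \<in> I) \<and>
    (\<forall>J. left_ideal A J \<and> I \<subseteq> J \<longrightarrow> J = I \<or> J = A)"

definition jacobson_radical ::
    "('h::complex_hilbert_space \<Rightarrow>\<^sub>L 'h) set \<Rightarrow> ('h \<Rightarrow>\<^sub>L 'h) set"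
  where "jacobson_radical A = {a \<in> A. \<forall>I. maximal_modular_left_ideal A I \<longrightarrow> a \<in> I}"

definition semisimple_algebra :: "('h::complex_hilbert_space \<Rightarrow>\<^sub>L 'h) set \<Rightarrow> bool"
  where "semisimple_algebra A \<longleftrightarrow> jacobson_radical A = {0}"

definition minimal_idempotent ::
    "('h::complex_hilbert_space \<Rightarrow>\<^sub>L 'h) set \<Rightarrow> ('h \<Rightarrow>\<^sub>L 'h) \<Rightarrow> bool"
  where "minimal_idempotent A e \<longleftrightarrow>
    e \<in> A \<and> e \<noteq> 0 \<and> (e o\<^sub>L e) = e \<and> (\<lambda>a. e o\<^sub>L a) ` A = range (\<lambda>c. c *\<^sub>C e)"

text \<open>This is the socle when \<open>A\<close> is commutative and semisimple.\<close>

definition socle :: "('h::complex_hilbert_space \<Rightarrow>\<^sub>L 'h) set \<Rightarrow> ('h \<Rightarrow>\<^sub>L 'h) set"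
  where "socle A = complex_vector.span {e. minimal_idempotent A e}"

text \<open>A bounded net in \<open>S\<close> is represented by the filter generated by its tails.\<close>

definition has_bounded_approximate_identity ::
    "('h::complex_hilbert_space \<Rightarrow>\<^sub>L 'h) set \<Rightarrow> bool"
  where "has_bounded_approximate_identity S \<longleftrightarrow>
    (\<exists>F M. F \<noteq> bot \<and> eventually (\<lambda>e. e \<in> S \<and> norm e \<le> M) F \<and>
      (\<forall>a\<in>S. ((\<lambda>e. e o\<^sub>L a) \<longlongrightarrow> a) F \<and> ((\<lambda>e. a o\<^sub>L e) \<longlongrightarrow> a) F))"

text \<open>A closed algebra \<open>A\<close> contains the closures below, so it does not matter that they are taken
  in the whole operator space.\<close>

definition compact_algebra :: "('h::complex_hilbert_space \<Rightarrow>\<^sub>L 'h) set \<Rightarrow> bool"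
  where "compact_algebra A \<longleftrightarrow>
    (\<forall>a\<in>A. compact (closure ((\<lambda>b. a o\<^sub>L b) ` {b \<in> A. norm b \<le> 1})))"

end

theory Submission
  imports Defs "HOL-Computational_Algebra.Fundamental_Theorem_Algebra"
begin

text \<open>
  The single generator makes \<open>A\<close> commutative (\<open>topologically_singly_generated_commute\<close>).

  Multiplication by a minimal idempotent has rank one, so multiplication by an element of the socle
  has finite rank, and a norm limit of compact operators is compact.  Hence a dense socle makes
  \<open>A\<close> compact (\<open>dense_socle_imp_compact\<close>).

  Conversely, let \<open>A\<close> be compact and let \<open>(e\<^sub>t)\<close> be a bounded approximate identity of the socle.
  For \<open>a \<in> A\<close> the net \<open>(a e\<^sub>t)\<close> lies in the socle and in a compact set, so it has a cluster point
  \<open>l\<close> in the closure of the socle.  For a minimal idempotent \<open>f\<close> the net \<open>f a e\<^sub>t = a e\<^sub>t f\<close> converges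
  to \<open>a f\<close>, so \<open>f (a - l) = 0\<close>.  It remains to see that only \<open>0\<close> is annihilated by all minimal
  idempotents (\<open>minimal_idempotents_separate\<close>); then \<open>a = l\<close> is in the closure of the socle.

  So let \<open>b \<noteq> 0\<close>.  By semisimplicity \<open>b\<close> is outside some maximal modular ideal, and modulo
  that ideal some multiple \<open>v = b c\<close> is a unit.  Thus \<open>1 - v\<close> is not surjective on \<open>A\<close>, and since
  multiplication by \<open>v\<close> is compact, it has a nonzero fixed point
  (\<open>compact_fredholm_alternative\<close>).  On the ideal of fixed points of \<open>v\<close> the unit ball is relatively
  compact, so strict chains of closed subspaces stop there.  For the powers of an element this
  yields a polynomial relation and, as there are no nilpotents, an idempotent; for idempotents it
  yields a minimal one \<open>f\<close>.  From \<open>f = v f = b c f\<close> it follows that \<open>b f \<noteq> 0\<close>.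
\<close>

section \<open>Separated sequences and closed subspaces\<close>

subclass (in complex_hilbert_space) banach ..

lemma compact_no_separated_sequence:
  fixes u :: "nat \<Rightarrow> 'a::metric_space"
  assumes "compact C" "\<And>n. u n \<in> C" "0 < d"
    and sep: "\<And>m n. m < n \<Longrightarrow> d \<le> dist (u m) (u n)"
  shows False
proof -
  obtain l r where r: "strict_mono (r :: nat \<Rightarrow> nat)" and l: "(u \<circ> r) \<longlonglongrightarrow> l"
    using assms(1,2) seq_compactE[of C u] compact_imp_seq_compact by metis
  have "Cauchy (u \<circ> r)"
    using l by (rule LIMSEQ_imp_Cauchy)
  then obtain N where "\<And>m n. m \<ge> N \<Longrightarrow> n \<ge> N \<Longrightarrow> dist ((u \<circ> r) m) ((u \<circ> r) n) < d"
    using \<open>0 < d\<close> unfolding Cauchy_def by metis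
  from this[of N "Suc N"] sep[of "r N" "r (Suc N)"] r show False
    by (simp add: strict_mono_def)
qed

text \<open>Riesz's lemma.  Strict chains of closed subspaces are refuted by it together with
  \<open>compact_no_separated_sequence\<close>: one unit vector from each step gives a separated sequence.\<close>

lemma riesz_unit_vector:
  fixes U V :: "'a::real_normed_vector set"
  assumes U: "subspace U" and V: "subspace V" "closed V" and "V \<subseteq> U" "U \<noteq> V"
  obtains u where "u \<in> U" "norm u = 1" "\<And>w. w \<in> V \<Longrightarrow> 1 / 2 \<le> dist u w"
proof -
  \<comment> \<open>Normalise \<open>x - v\<close>, where \<open>v \<in> V\<close> realises the distance from \<open>x\<close> to \<open>V\<close> up to a factor of 2.\<close>
  obtain x where x: "x \<in> U" "x \<notin> V" using assms by blast
  have ne: "V \<noteq> {}" using subspace_0[OF V(1)] by auto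
  define d where "d = infdist x V"
  have d: "0 < d"
    using x ne V(2) in_closed_iff_infdist_zero[of V x] infdist_nonneg[of x V]
    unfolding d_def by fastforce
  have "\<exists>v\<in>V. dist x v < 2 * d"
  proof (rule ccontr)
    assume "\<not> ?thesis"
    then have "\<And>v. v \<in> V \<Longrightarrow> 2 * d \<le> dist x v" by force
    then have "2 * d \<le> d"
      unfolding d_def using ne by (subst (2) infdist_def) (auto intro!: cINF_greatest)
    with d show False by simp
  qed
  then obtain v where v: "v \<in> V" "norm (x - v) < 2 * d" by (auto simp: dist_norm)
  define n where "n = norm (x - v)"
  have n: "0 < n" "n < 2 * d" using v x unfolding n_def by auto
  show thesis
  proof
    show "(1 / n) *\<^sub>R (x - v) \<in> U"
      using x v assms by (intro subspace_scale subspace_diff) auto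
    show "norm ((1 / n) *\<^sub>R (x - v)) = 1"
      using n unfolding n_def by simp
    fix w assume w: "w \<in> V"
    have "v + n *\<^sub>R w \<in> V" using w v V(1) by (intro subspace_add subspace_scale) auto
    then have "d \<le> norm (x - (v + n *\<^sub>R w))"
      unfolding d_def using infdist_le by (metis dist_norm)
    also have "x - (v + n *\<^sub>R w) = n *\<^sub>R ((1 / n) *\<^sub>R (x - v) - w)"
      using n by (simp add: algebra_simps)
    also have "norm \<dots> = n * dist ((1 / n) *\<^sub>R (x - v)) w"
      using n by (simp add: dist_norm)
    finally have "n / 2 \<le> n * dist ((1 / n) *\<^sub>R (x - v)) w" using n by linarith
    then show "1 / 2 \<le> dist ((1 / n) *\<^sub>R (x - v)) w" using n by (simp add: field_simps)
  qed
qed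

lemma complex_subspace_imp_subspace:
  "complex_vector.subspace V \<Longrightarrow> subspace V"
  unfolding subspace_def complex_vector.subspace_def
  by (simp flip: scaleC_of_real)

lemma bounded_linear_scaleC_left: "bounded_linear (\<lambda>c. c *\<^sub>C x)"
proof (rule bounded_linear_intro[where K = "norm x"])
  show "(r *\<^sub>R c) *\<^sub>C x = r *\<^sub>R c *\<^sub>C x" for r and c :: complex
    unfolding scaleR_conv_of_real scaleC_scaleC[symmetric] scaleC_of_real ..
qed (simp_all add: scaleC_add_left norm_scaleC)

text \<open>In a limit of vectors \<open>v\<^sub>n + k\<^sub>n x\<close> the coefficients \<open>k\<^sub>n\<close> converge, because the distance from
  \<open>x\<close> to the span of \<open>S\<close> is positive and bounds their differences.\<close>

lemma closed_complex_span_insert: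
  fixes x :: "'a::complex_normed_vector"
  assumes S: "closed (complex_vector.span S)"
  shows "closed (complex_vector.span (insert x S))"
proof (cases "x \<in> complex_vector.span S")
  case True
  then show ?thesis using S complex_vector.span_redundant by metis
next
  case False
  let ?V = "complex_vector.span S"
  have ne: "?V \<noteq> {}" using complex_vector.span_zero by blast
  define d where "d = infdist x ?V"
  have d: "0 < d"
    using False ne S in_closed_iff_infdist_zero[of ?V x] infdist_nonneg[of x ?V]
    unfolding d_def by fastforce
  have bound: "cmod c * d \<le> norm (c *\<^sub>C x + v)" if "v \<in> ?V" for c v
  proof (cases "c = 0")
    case False
    have "- (inverse c *\<^sub>C v) \<in> ?V"
      using that complex_vector.span_neg complex_vector.span_scale by blast
    then have "d \<le> norm (x + inverse c *\<^sub>C v)"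
      unfolding d_def using infdist_le[of "- (inverse c *\<^sub>C v)" ?V x] by (simp add: dist_norm)
    then have "cmod c * d \<le> norm (c *\<^sub>C (x + inverse c *\<^sub>C v))"
      by (simp add: norm_scaleC mult_left_mono)
    also have "c *\<^sub>C (x + inverse c *\<^sub>C v) = c *\<^sub>C x + v"
      using False by (simp add: scaleC_add_right scaleC_scaleC)
    finally show ?thesis .
  qed simp
  show ?thesis
  proof (unfold closed_sequential_limits, intro allI impI, elim conjE)
    fix f l assume f: "\<forall>n. f n \<in> complex_vector.span (insert x S)" and l: "f \<longlonglongrightarrow> l"
    then have "\<forall>n. \<exists>k. f n - k *\<^sub>C x \<in> ?V"
      by (simp add: complex_vector.span_breakdown_eq)
    then obtain k where k: "\<And>n. f n - k n *\<^sub>C x \<in> ?V" by metis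
    have diff: "cmod (k m - k n) * d \<le> norm (f m - f n)" for m n
    proof -
      have "(f m - k m *\<^sub>C x) - (f n - k n *\<^sub>C x) \<in> ?V"
        using k complex_vector.span_diff by blast
      from bound[OF this, of "k m - k n"] show ?thesis
        by (simp add: complex_vector.scale_left_diff_distrib algebra_simps)
    qed
    have "Cauchy k"
    proof (rule CauchyI)
      fix e :: real assume "0 < e"
      then obtain M where M: "\<And>m n. m \<ge> M \<Longrightarrow> n \<ge> M \<Longrightarrow> norm (f m - f n) < e * d"
        using LIMSEQ_imp_Cauchy[OF l] d CauchyD[of f "e * d"] by auto
      have "cmod (k m - k n) < e" if "m \<ge> M" "n \<ge> M" for m n
      proof -
        have "cmod (k m - k n) * d < e * d"
          using diff[of m n] M[OF that] by linarith
        then show ?thesis using d by simp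
      qed
      then show "\<exists>M. \<forall>m\<ge>M. \<forall>n\<ge>M. norm (k m - k n) < e" by blast
    qed
    then obtain c where c: "k \<longlonglongrightarrow> c"
      using Cauchy_convergent[of k] unfolding convergent_def by auto
    have "(\<lambda>n. k n *\<^sub>C x) \<longlonglongrightarrow> c *\<^sub>C x"
      by (rule bounded_linear.tendsto[OF bounded_linear_scaleC_left c])
    then have "(\<lambda>n. f n - k n *\<^sub>C x) \<longlonglongrightarrow> l - c *\<^sub>C x" by (rule tendsto_diff[OF l])
    then have "l - c *\<^sub>C x \<in> ?V" by (rule closed_sequentially[OF S k])
    then show "l \<in> complex_vector.span (insert x S)"
      unfolding complex_vector.span_breakdown_eq by (rule exI)
  qed
qed

lemma closed_complex_span_finite:
  fixes S :: "'a::complex_normed_vector set"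
  shows "finite S \<Longrightarrow> closed (complex_vector.span S)"
  by (induction S rule: finite_induct) (auto intro: closed_complex_span_insert)

section \<open>Polynomials in an operator\<close>

lemmas compose_add_left = bounded_bilinear.add_left[OF bounded_bilinear_blinfun_compose]
lemmas compose_add_right = bounded_bilinear.add_right[OF bounded_bilinear_blinfun_compose]
lemmas compose_diff_left = bounded_bilinear.diff_left[OF bounded_bilinear_blinfun_compose]
lemmas compose_diff_right = bounded_bilinear.diff_right[OF bounded_bilinear_blinfun_compose]

lemma compose_assoc: "(a o\<^sub>L b) o\<^sub>L c = a o\<^sub>L (b o\<^sub>L c)"
  by (rule blinfun_eqI) simp

lemma compose_scaleC_left: "(c *\<^sub>C a) o\<^sub>L b = c *\<^sub>C (a o\<^sub>L b)"
  by (rule blinfun_eqI) (simp add: scaleC_blinfun.rep_eq)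

lemma compose_scaleC_right:
  "a \<in> bounded_operators \<Longrightarrow> a o\<^sub>L (c *\<^sub>C b) = c *\<^sub>C (a o\<^sub>L b)"
  by (rule blinfun_eqI) (simp add: scaleC_blinfun.rep_eq bounded_operators_def)

lemma compose_id [simp]: "a o\<^sub>L id_blinfun = a" "id_blinfun o\<^sub>L a = a"
  by (rule blinfun_eqI, simp)+

text \<open>The evaluation \<open>p(y)\<close> by Horner's scheme, with the constant term multiplying the identity
  operator.  Since the identity need not belong to a given algebra, membership in the
  algebra generated by \<open>y\<close> is available only for \<open>y p(y)\<close>.\<close>

definition poly_operator ::
    "('h::complex_hilbert_space \<Rightarrow>\<^sub>L 'h) \<Rightarrow> complex poly \<Rightarrow> 'h \<Rightarrow>\<^sub>L 'h"
  where "poly_operator y p = fold_coeffs (\<lambda>a q. a *\<^sub>C id_blinfun + (y o\<^sub>L q)) p 0"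

lemma poly_operator_0 [simp]: "poly_operator y 0 = 0"
  by (simp add: poly_operator_def)

lemma poly_operator_pCons:
  "poly_operator y (pCons a p) = a *\<^sub>C id_blinfun + (y o\<^sub>L poly_operator y p)"
  by (cases "a = 0 \<and> p = 0") (auto simp: poly_operator_def)

lemma poly_operator_add: "poly_operator y (p + q) = poly_operator y p + poly_operator y q"
  by (induction p q rule: poly_induct2)
    (simp_all add: poly_operator_pCons compose_add_right scaleC_add_left)

lemma poly_operator_smult:
  "y \<in> bounded_operators \<Longrightarrow> poly_operator y (smult c p) = c *\<^sub>C poly_operator y p"
  by (induction p)
    (simp_all add: poly_operator_pCons compose_scaleC_right scaleC_add_right scaleC_scaleC)

lemma poly_operator_diff:
  assumes "y \<in> bounded_operators"
  shows "poly_operator y (p - q) = poly_operator y p - poly_operator y q"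
  using poly_operator_add[of y p "smult (-1) q"] poly_operator_smult[OF assms, of "-1" q]
  by simp

lemma poly_operator_linear_factor:
  assumes "y \<in> bounded_operators"
  shows "poly_operator y ([:-c, 1:] * q) = (y o\<^sub>L poly_operator y q) - c *\<^sub>C poly_operator y q"
  using assms
  by (simp add: poly_operator_add poly_operator_diff poly_operator_smult poly_operator_pCons)

lemma poly_operator_eigenvector:
  assumes "y \<in> bounded_operators" "y o\<^sub>L z = c *\<^sub>C z"
  shows "poly_operator y p o\<^sub>L z = poly p c *\<^sub>C z"
proof (induction p)
  case (pCons a p)
  then show ?case using assms
    by (simp add: poly_operator_pCons compose_add_left compose_scaleC_left compose_assoc
        compose_scaleC_right scaleC_add_left scaleC_scaleC mult.commute)
qed simp


section \<open>Commutative operator algebras\<close>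

text \<open>The relative commutant of any set \<open>S \<subseteq> A\<close> is an operator algebra.  Taking \<open>S\<close> to be the
  generator shows that the generator is central; hence it lies in the relative commutant of
  \<open>S = A\<close>, which therefore is all of \<open>A\<close>.\<close>

lemma topologically_singly_generated_commute:
  assumes A: "operator_algebra A" and gen: "topologically_singly_generated A"
    and "a \<in> A" "b \<in> A"
  shows "a o\<^sub>L b = b o\<^sub>L a"
proof -
  obtain x where x: "x \<in> A" and min: "\<And>B. operator_algebra B \<Longrightarrow> x \<in> B \<Longrightarrow> A \<subseteq> B"
    using gen unfolding topologically_singly_generated_def by blast
  have commutant: "operator_algebra {b \<in> A. \<forall>s\<in>S. b o\<^sub>L s = s o\<^sub>L b}" if S: "S \<subseteq> A" for S
    unfolding operator_algebra_def
  proof (intro conjI ballI)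
    have bdd: "A \<subseteq> bounded_operators" and sub: "complex_vector.subspace A"
      and mult: "\<And>a b. a \<in> A \<Longrightarrow> b \<in> A \<Longrightarrow> a o\<^sub>L b \<in> A" and "closed A"
      using A unfolding operator_algebra_def by auto
    show "{b \<in> A. \<forall>s\<in>S. b o\<^sub>L s = s o\<^sub>L b} \<subseteq> bounded_operators" using bdd by blast
    show "complex_vector.subspace {b \<in> A. \<forall>s\<in>S. b o\<^sub>L s = s o\<^sub>L b}"
      using sub bdd S
      by (auto simp: complex_vector.subspace_def compose_add_left compose_add_right
          compose_scaleC_left compose_scaleC_right subset_iff)
    show "(c o\<^sub>L d) \<in> {b \<in> A. \<forall>s\<in>S. b o\<^sub>L s = s o\<^sub>L b}"
      if "c \<in> {b \<in> A. \<forall>s\<in>S. b o\<^sub>L s = s o\<^sub>L b}" "d \<in> {b \<in> A. \<forall>s\<in>S. b o\<^sub>L s = s o\<^sub>L b}" for c d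
      using that mult by (auto simp: compose_assoc) (metis compose_assoc)
    have "{b \<in> A. \<forall>s\<in>S. b o\<^sub>L s = s o\<^sub>L b} = A \<inter> (\<Inter>s\<in>S. {b. b o\<^sub>L s = s o\<^sub>L b})"
      by auto
    moreover have "closed {b. b o\<^sub>L s = s o\<^sub>L b}" for s :: "'a \<Rightarrow>\<^sub>L 'a"
      by (intro closed_Collect_eq continuous_intros)
    ultimately show "closed {b \<in> A. \<forall>s\<in>S. b o\<^sub>L s = s o\<^sub>L b}"
      using \<open>closed A\<close> by (simp add: closed_INT closed_Int)
  qed
  have "A \<subseteq> {b \<in> A. \<forall>s\<in>{x}. b o\<^sub>L s = s o\<^sub>L b}"
    using x by (intro min commutant) auto
  then have "A \<subseteq> {b \<in> A. \<forall>s\<in>A. b o\<^sub>L s = s o\<^sub>L b}"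
    using x A by (intro min commutant) auto
  with assms show ?thesis by blast
qed

locale commutative_operator_algebra =
  fixes A :: "('h::complex_hilbert_space \<Rightarrow>\<^sub>L 'h) set"
  assumes algebra: "operator_algebra A"
    and commute: "a \<in> A \<Longrightarrow> b \<in> A \<Longrightarrow> a o\<^sub>L b = b o\<^sub>L a"
begin

lemma bounded: "a \<in> A \<Longrightarrow> a \<in> bounded_operators"
  and subspace: "complex_vector.subspace A"
  and compose_mem: "a \<in> A \<Longrightarrow> b \<in> A \<Longrightarrow> a o\<^sub>L b \<in> A"
  and closed: "closed A"
  using algebra unfolding operator_algebra_def by auto

lemmas zero_mem = complex_vector.subspace_0[OF subspace]
  and add_mem = complex_vector.subspace_add[OF subspace]
  and diff_mem = complex_vector.subspace_diff[OF subspace]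
  and scaleC_mem = complex_vector.subspace_scale[OF subspace]

lemma scaleR_mem: "a \<in> A \<Longrightarrow> r *\<^sub>R a \<in> A"
  using scaleC_mem[of a "complex_of_real r"] by (simp add: scaleC_of_real)

lemma compose_poly_operator_mem:
  assumes "y \<in> A" shows "y o\<^sub>L poly_operator y p \<in> A"
proof (induction p)
  case (pCons a p)
  have "y o\<^sub>L (a *\<^sub>C id_blinfun) = a *\<^sub>C y"
    using compose_scaleC_right[OF bounded[OF assms], of a id_blinfun] by simp
  with pCons assms show ?case
    by (simp add: poly_operator_pCons compose_add_right add_mem scaleC_mem compose_mem)
qed (simp add: zero_mem)

lemma left_idealI_preimage:
  assumes I: "left_ideal A I" and y: "y \<in> A"
  shows "left_ideal A {a \<in> A. a o\<^sub>L y \<in> I}"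
  using I subspace y unfolding left_ideal_def complex_vector.subspace_def
  by (auto simp: compose_add_left compose_scaleC_left compose_mem compose_assoc)

text \<open>For a maximal modular ideal \<open>I\<close> the ideal \<open>{a. a y \<in> I}\<close> contains \<open>I\<close>, so it is \<open>I\<close> or \<open>A\<close>.
  It contains \<open>y\<close>, and if it contains the modular unit then \<open>y \<in> I\<close> as well.  So an element of
  square zero is in the radical.\<close>

lemma square_zero:
  assumes ss: "semisimple_algebra A" and y: "y \<in> A" "y o\<^sub>L y = 0"
  shows "y = 0"
proof -
  have "y \<in> I" if max: "maximal_modular_left_ideal A I" for I
  proof -
    have I: "left_ideal A I" using max unfolding maximal_modular_left_ideal_def by blast
    obtain u where u: "u \<in> A" "\<And>a. a \<in> A \<Longrightarrow> a - (a o\<^sub>L u) \<in> I"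
      using max unfolding maximal_modular_left_ideal_def by blast
    let ?J = "{a \<in> A. a o\<^sub>L y \<in> I}"
    have "I \<subseteq> ?J"
    proof
      fix i assume i: "i \<in> I"
      then have "i \<in> A" "y o\<^sub>L i \<in> I" using I y unfolding left_ideal_def by auto
      then show "i \<in> ?J" using commute[of i y] y by simp
    qed
    then consider "?J = I" | "?J = A"
      using max left_idealI_preimage[OF I y(1)] unfolding maximal_modular_left_ideal_def by blast
    then show ?thesis
    proof cases
      case 1
      have "0 \<in> I" using I unfolding left_ideal_def complex_vector.subspace_def by blast
      then have "y \<in> ?J" using y by simp
      with 1 show ?thesis by blast
    next
      case 2
      then have "u o\<^sub>L y \<in> I" using u by blast
      then have "y o\<^sub>L u \<in> I" using commute u y by simp
      moreover have "y - (y o\<^sub>L u) \<in> I" using u y by blast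
      moreover have "y = (y - (y o\<^sub>L u)) + (y o\<^sub>L u)" by simp
      ultimately show ?thesis
        using I complex_vector.subspace_add unfolding left_ideal_def by metis
    qed
  qed
  then have "y \<in> jacobson_radical A" using y unfolding jacobson_radical_def by blast
  then show ?thesis using ss unfolding semisimple_algebra_def by blast
qed

text \<open>Let \<open>I\<close> be a maximal modular ideal that misses \<open>b\<close>.  Then \<open>I + b A = A\<close>, so some \<open>b c\<close> is
  congruent modulo \<open>I\<close> to the modular unit.  This puts every \<open>a - b c a\<close> into \<open>I\<close>, which is why
  multiplication by \<open>1 - b c\<close> is not surjective.\<close>

lemma modular_unit_in_principal_ideal:
  assumes ss: "semisimple_algebra A" and b: "b \<in> A" "b \<noteq> 0"
  obtains c where "c \<in> A" "(\<lambda>a. a - ((b o\<^sub>L c) o\<^sub>L a)) ` A \<noteq> A"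
proof -
  have "b \<notin> jacobson_radical A" using ss b unfolding semisimple_algebra_def by auto
  then obtain I where max: "maximal_modular_left_ideal A I" and bI: "b \<notin> I"
    using b unfolding jacobson_radical_def by blast
  have I: "left_ideal A I" and "I \<noteq> A"
    using max unfolding maximal_modular_left_ideal_def by auto
  have IA: "I \<subseteq> A" and Isub: "complex_vector.subspace I"
    and Imult: "\<And>a i. a \<in> A \<Longrightarrow> i \<in> I \<Longrightarrow> a o\<^sub>L i \<in> I"
    using I unfolding left_ideal_def by auto
  obtain u where u: "u \<in> A" "\<And>a. a \<in> A \<Longrightarrow> a - (a o\<^sub>L u) \<in> I"
    using max unfolding maximal_modular_left_ideal_def by blast
  let ?J = "{i + (b o\<^sub>L c) | i c. i \<in> I \<and> c \<in> A}"
  have "left_ideal A ?J"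
    unfolding left_ideal_def complex_vector.subspace_def
  proof (intro conjI ballI allI)
    show "?J \<subseteq> A" using IA b by (auto intro!: add_mem compose_mem)
    show "0 \<in> ?J"
      using complex_vector.subspace_0[OF Isub] zero_mem by force
    show "x + y \<in> ?J" if xy: "x \<in> ?J" "y \<in> ?J" for x y
    proof -
      obtain i c j d where "x = i + (b o\<^sub>L c)" "y = j + (b o\<^sub>L d)" "i \<in> I" "j \<in> I" "c \<in> A" "d \<in> A"
        using xy by blast
      then have "x + y = (i + j) + (b o\<^sub>L (c + d))" "i + j \<in> I" "c + d \<in> A"
        using complex_vector.subspace_add[OF Isub] add_mem by (auto simp: compose_add_right)
      then show ?thesis by blast
    qed
    show "r *\<^sub>C x \<in> ?J" if x: "x \<in> ?J" for r x
    proof -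
      obtain i c where "x = i + (b o\<^sub>L c)" "i \<in> I" "c \<in> A" using x by blast
      then have "r *\<^sub>C x = r *\<^sub>C i + (b o\<^sub>L (r *\<^sub>C c))" "r *\<^sub>C i \<in> I" "r *\<^sub>C c \<in> A"
        using complex_vector.subspace_scale[OF Isub] scaleC_mem bounded b
        by (auto simp: compose_scaleC_right scaleC_add_right)
      then show ?thesis by blast
    qed
    show "(a o\<^sub>L x) \<in> ?J" if a: "a \<in> A" and x: "x \<in> ?J" for a x
    proof -
      obtain i c where x: "x = i + (b o\<^sub>L c)" "i \<in> I" "c \<in> A" using x by blast
      have "a o\<^sub>L (b o\<^sub>L c) = b o\<^sub>L (a o\<^sub>L c)"
        using commute[OF a b(1)] by (metis compose_assoc)
      then have "a o\<^sub>L x = (a o\<^sub>L i) + (b o\<^sub>L (a o\<^sub>L c))" "a o\<^sub>L i \<in> I" "a o\<^sub>L c \<in> A"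
        using x a Imult compose_mem by (auto simp: compose_add_right)
      then show ?thesis by blast
    qed
  qed
  moreover have "I \<subseteq> ?J"
    using zero_mem by force
  ultimately consider "?J = I" | "?J = A"
    using max unfolding maximal_modular_left_ideal_def by blast
  then show thesis
  proof cases
    case 1
    have "0 + (b o\<^sub>L u) \<in> ?J" using complex_vector.subspace_0[OF Isub] u by blast
    then have "b o\<^sub>L u \<in> I" using 1 by simp
    moreover have "b - (b o\<^sub>L u) \<in> I" using u b by blast
    ultimately have "(b - (b o\<^sub>L u)) + (b o\<^sub>L u) \<in> I"
      using complex_vector.subspace_add[OF Isub] by blast
    with bI show ?thesis by simp
  next
    case 2
    then obtain i c where ic: "u = i + (b o\<^sub>L c)" "i \<in> I" "c \<in> A" using u by blast
    have "a - ((b o\<^sub>L c) o\<^sub>L a) \<in> I" if a: "a \<in> A" for a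
    proof -
      have "(b o\<^sub>L c) o\<^sub>L a = a o\<^sub>L (b o\<^sub>L c)" using commute a b ic compose_mem by metis
      also have "\<dots> = (a o\<^sub>L u) - (a o\<^sub>L i)" using ic by (simp add: compose_add_right)
      finally have "a - ((b o\<^sub>L c) o\<^sub>L a) = (a - (a o\<^sub>L u)) + (a o\<^sub>L i)" by simp
      then show ?thesis
        using u(2)[OF a] Imult[OF a ic(2)] complex_vector.subspace_add[OF Isub] by metis
    qed
    then have "(\<lambda>a. a - ((b o\<^sub>L c) o\<^sub>L a)) ` A \<subseteq> I" by blast
    then show ?thesis using that ic \<open>I \<noteq> A\<close> IA by blast
  qed
qed

section \<open>Compact multiplication operators\<close>

lemma compact_multiplication:
  assumes C: "compact_algebra A" and v: "v \<in> A"
  obtains K where "compact K" "\<And>b. b \<in> A \<Longrightarrow> norm b \<le> 1 \<Longrightarrow> v o\<^sub>L b \<in> K"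
proof
  show "compact (closure ((\<lambda>b. v o\<^sub>L b) ` {b \<in> A. norm b \<le> 1}))"
    using C v unfolding compact_algebra_def by blast
qed (rule subsetD[OF closure_subset], blast)

text \<open>Riesz's argument.  If \<open>S = 1 - v\<close> is injective on \<open>A\<close>, compactness makes it bounded below, so
  the ranges \<open>S\<^sup>n A\<close> are closed.  If moreover \<open>S\<close> is not surjective, they decrease strictly,
  and \<open>v x - v x' = x - (S x + x' - S x')\<close> shows that multiplication by \<open>v\<close> keeps the Riesz vectors
  of this chain separated.\<close>

lemma compact_fredholm_alternative:
  assumes C: "compact_algebra A" and v: "v \<in> A"
    and range: "(\<lambda>a. a - (v o\<^sub>L a)) ` A \<noteq> A"
  obtains y where "y \<in> A" "y \<noteq> 0" "v o\<^sub>L y = y"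
proof (rule ccontr)
  assume "\<not> thesis"
  then have inj: "\<And>y. y \<in> A \<Longrightarrow> v o\<^sub>L y = y \<Longrightarrow> y = 0" using that by blast
  define S :: "('h \<Rightarrow>\<^sub>L 'h) \<Rightarrow> 'h \<Rightarrow>\<^sub>L 'h" where "S a = a - (v o\<^sub>L a)" for a
  obtain K where K: "compact K" "\<And>b. b \<in> A \<Longrightarrow> norm b \<le> 1 \<Longrightarrow> v o\<^sub>L b \<in> K"
    using compact_multiplication[OF C v] by blast
  have S_lin: "bounded_linear S"
    unfolding S_def
    by (intro bounded_linear_sub bounded_linear_ident bounded_bilinear.bounded_linear_right[OF bounded_bilinear_blinfun_compose])
  interpret S: bounded_linear S by (rule S_lin)
  have S_mem: "S a \<in> A" if "a \<in> A" for a
    using that v unfolding S_def by (intro diff_mem compose_mem)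
  \<comment> \<open>Otherwise some unit vectors \<open>z\<^sub>n\<close> have \<open>S z\<^sub>n \<rightarrow> 0\<close>; a limit point of \<open>v z\<^sub>n\<close> would be a fixed
    point of norm 1.\<close>
  have "\<exists>e>0. \<forall>x\<in>A. e * norm x \<le> norm (S x)"
  proof (rule ccontr)
    assume "\<not> ?thesis"
    then have "\<forall>n. \<exists>x\<in>A. norm (S x) < inverse (real (Suc n)) * norm x"
      by (metis inverse_positive_iff_positive not_le of_nat_0_less_iff zero_less_Suc)
    then obtain x where x: "\<And>n. x n \<in> A" "\<And>n. norm (S (x n)) < inverse (real (Suc n)) * norm (x n)"
      by metis
    define z where "z n = (1 / norm (x n)) *\<^sub>R x n" for n
    have nz: "norm (x n) > 0" for n
      using x(2)[of n] by (cases "x n = 0") (auto simp: S.zero)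
    have z: "z n \<in> A" "norm (z n) = 1" "norm (S (z n)) < inverse (real (Suc n))" for n
      using x(1)[of n] x(2)[of n] nz[of n]
      by (auto simp: z_def scaleR_mem S.scaleR field_simps)
    have "v o\<^sub>L z n \<in> K" for n using z K by simp
    then obtain l r where r: "strict_mono (r :: nat \<Rightarrow> nat)"
      and l: "((\<lambda>n. v o\<^sub>L z n) \<circ> r) \<longlonglongrightarrow> l"
      using K(1) seq_compactE[of K "\<lambda>n. v o\<^sub>L z n"] compact_imp_seq_compact by metis
    have "(\<lambda>n. S (z n)) \<longlonglongrightarrow> 0"
    proof (rule Lim_null_comparison)
      show "\<forall>\<^sub>F n in sequentially. norm (S (z n)) \<le> inverse (real (Suc n))"
        by (intro always_eventually allI less_imp_le z(3))
      show "(\<lambda>n. inverse (real (Suc n))) \<longlonglongrightarrow> 0" by (rule LIMSEQ_inverse_real_of_nat)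
    qed
    then have "((\<lambda>n. S (z n)) \<circ> r) \<longlonglongrightarrow> 0" by (rule LIMSEQ_subseq_LIMSEQ[OF _ r])
    then have "(\<lambda>n. ((\<lambda>n. v o\<^sub>L z n) \<circ> r) n + ((\<lambda>n. S (z n)) \<circ> r) n) \<longlonglongrightarrow> l + 0"
      by (rule tendsto_add[OF l])
    then have zl: "(\<lambda>n. z (r n)) \<longlonglongrightarrow> l" by (simp add: S_def)
    then have "l \<in> A" using closed_sequentially[OF closed, of "\<lambda>n. z (r n)" l] z by simp
    have "(\<lambda>n. norm (z (r n))) \<longlonglongrightarrow> norm l" by (rule tendsto_norm[OF zl])
    then have "norm l = 1" using z(2) by (simp add: LIMSEQ_const_iff)
    have "(\<lambda>n. v o\<^sub>L z (r n)) \<longlonglongrightarrow> (v o\<^sub>L l)" using zl by (intro tendsto_intros)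
    then have "v o\<^sub>L l = l" using l LIMSEQ_unique by (auto simp: o_def)
    with inj \<open>l \<in> A\<close> \<open>norm l = 1\<close> show False by force
  qed
  then obtain e where e: "0 < e" "\<And>x. x \<in> A \<Longrightarrow> e * norm x \<le> norm (S x)" by blast
  define R where "R n = (S ^^ n) ` A" for n
  have R_Suc: "R (Suc n) = S ` R n" for n unfolding R_def by (simp add: image_comp o_def)
  have R0: "R 0 = A" by (simp add: R_def)
  have R_sub: "subspace (R n) \<and> complete (R n) \<and> R n \<subseteq> A" for n
  proof (induction n)
    case 0
    show ?case using complex_subspace_imp_subspace[OF subspace] closed
      by (simp add: R0 complete_eq_closed)
  next
    case (Suc n)
    then show ?case unfolding R_Suc
      using S_mem linear_subspace_image[OF S.linear] e
        complete_isometric_image[OF e(1) _ S_lin, of "R n"] by blast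
  qed
  have R_dec: "R (Suc n) \<subseteq> R n \<and> R (Suc n) \<noteq> R n" for n
  proof (induction n)
    case 0
    show ?case using range S_mem unfolding R_Suc R0 S_def by blast
  next
    case (Suc n)
    have "inj_on S A"
    proof (rule inj_onI)
      fix a b assume "a \<in> A" "b \<in> A" "S a = S b"
      then have "a - b \<in> A" "S (a - b) = 0" by (auto simp: diff_mem S.diff)
      then have "a - b = 0" using inj[of "a - b"] by (simp add: S_def)
      then show "a = b" by simp
    qed
    then have "R (Suc (Suc n)) \<noteq> R (Suc n)"
      using Suc R_sub inj_on_image_eq_iff[of S A "R (Suc n)" "R n"] unfolding R_Suc[of "Suc n"] R_Suc[of n]
      by blast
    moreover have "R (Suc (Suc n)) \<subseteq> R (Suc n)" using Suc unfolding R_Suc by blast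
    ultimately show ?case by blast
  qed
  have "\<exists>u. u \<in> R n \<and> norm u = 1 \<and> (\<forall>w\<in>R (Suc n). 1 / 2 \<le> dist u w)" for n
    using riesz_unit_vector[of "R n" "R (Suc n)"] R_sub R_dec complete_imp_closed by metis
  then obtain x where x: "\<And>n. x n \<in> R n" "\<And>n. norm (x n) = 1"
    "\<And>n w. w \<in> R (Suc n) \<Longrightarrow> 1 / 2 \<le> dist (x n) w"
    by metis
  have R_mono: "R n \<subseteq> R m" if "m \<le> n" for m n
    using that R_dec by (metis lift_Suc_antimono_le)
  show False
  proof (rule compact_no_separated_sequence[OF K(1), of "\<lambda>n. v o\<^sub>L x n" "1/2"])
    show "v o\<^sub>L x n \<in> K" for n using x R_sub K by (metis order_refl subsetD)
    fix m n :: nat assume mn: "m < n"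
    have "S (x m) \<in> R (Suc m)" using x R_Suc by blast
    moreover have "x n \<in> R (Suc m)" using x R_mono[of "Suc m" n] mn by auto
    moreover have "S (x n) \<in> R (Suc m)" using x R_mono[of "Suc m" "Suc n"] R_Suc mn by auto
    ultimately have "S (x m) + x n - S (x n) \<in> R (Suc m)"
      using R_sub subspace_add subspace_diff by metis
    from x(3)[OF this] show "1 / 2 \<le> dist (v o\<^sub>L x m) (v o\<^sub>L x n)"
      by (simp add: dist_norm S_def algebra_simps)
  qed simp
qed

section \<open>Minimal idempotents\<close>

text \<open>The unit ball of the fixed space of \<open>v\<close> is relatively compact, so the spans of
  \<open>y, y\<^sup>2, \<dots>, y\<^sup>n\<close> become stationary and some \<open>p \<noteq> 0\<close> satisfies \<open>y p(y) = 0\<close>.  Take \<open>p\<close> of least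
  degree and split off a root, \<open>p = (X - c) q\<close>.  Then \<open>z = y q(y)\<close> is nonzero and \<open>y z = c z\<close>, so
  \<open>z\<^sup>2 = q(c) c z\<close>.  As \<open>A\<close> has no nilpotents, the factor \<open>q(c) c\<close> is nonzero, and dividing \<open>z\<close> by
  it gives an idempotent.\<close>

lemma eigenvector_idempotent:
  assumes ss: "semisimple_algebra A" and C: "compact_algebra A" and v: "v \<in> A"
    and y: "y \<in> A" "y \<noteq> 0" "v o\<^sub>L y = y"
  obtains g c where "g \<in> A" "g \<noteq> 0" "g o\<^sub>L g = g" "c \<noteq> 0" "y o\<^sub>L g = c *\<^sub>C g"
proof -
  obtain K where K: "compact K" "\<And>b. b \<in> A \<Longrightarrow> norm b \<le> 1 \<Longrightarrow> v o\<^sub>L b \<in> K"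
    using compact_multiplication[OF C v] by blast
  have yb: "y \<in> bounded_operators" using bounded y by blast
  let ?P = "\<lambda>p. y o\<^sub>L poly_operator y p"
  have P_fix: "v o\<^sub>L ?P p = ?P p" for p
    using y(3) by (simp flip: compose_assoc)
  define V where "V n = complex_vector.span ((\<lambda>k. ?P (monom 1 k)) ` {..<n})" for n
  have V_poly: "\<exists>q. (\<forall>k\<ge>n. coeff q k = 0) \<and> w = ?P q" if "w \<in> V n" for w n
    using that unfolding V_def
  proof (induction rule: complex_vector.span_induct_alt)
    case base
    show ?case by (rule exI[of _ 0]) simp
  next
    case (step c x w)
    then obtain k q where k: "k < n" "x = ?P (monom 1 k)"
      and q: "\<forall>k\<ge>n. coeff q k = 0" "w = ?P q" by blast
    have "c *\<^sub>C x + w = ?P (smult c (monom 1 k) + q)"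
      using k q yb
      by (simp only: poly_operator_add poly_operator_smult compose_add_right compose_scaleC_right)
    moreover have "\<forall>j\<ge>n. coeff (smult c (monom 1 k) + q) j = 0" using k q by simp
    ultimately show ?case by blast
  qed
  have V_mem: "w \<in> A" "v o\<^sub>L w = w" if "w \<in> V n" for w n
    using V_poly[OF that] compose_poly_operator_mem[OF y(1)] P_fix by auto
  have V_sub: "subspace (V n)" "closed (V n)" for n
    unfolding V_def
    by (auto intro: complex_subspace_imp_subspace closed_complex_span_finite)
  have V_mono: "V m \<subseteq> V n" if "m \<le> n" for m n
    unfolding V_def using that by (intro complex_vector.span_mono) auto
  obtain n where n: "V (Suc n) = V n"
  proof (rule ccontr)
    assume "\<not> thesis"
    then have "V (Suc n) \<noteq> V n" for n using that by blast
    then have "\<exists>u. u \<in> V (Suc n) \<and> norm u = 1 \<and> (\<forall>w\<in>V n. 1 / 2 \<le> dist u w)" for n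
      using riesz_unit_vector[OF V_sub(1) V_sub V_mono[of n "Suc n"]] by (metis le_SucI order_refl)
    then obtain u where u: "\<And>n. u n \<in> V (Suc n)" "\<And>n. norm (u n) = 1"
      "\<And>n w. w \<in> V n \<Longrightarrow> 1 / 2 \<le> dist (u n) w"
      by metis
    show False
    proof (rule compact_no_separated_sequence[OF K(1), of u "1/2"])
      show "u n \<in> K" for n using K(2)[of "u n"] V_mem[OF u(1)[of n]] u(2)[of n] by simp
      fix m n :: nat assume "m < n"
      then have "u m \<in> V n" using u(1) V_mono[of "Suc m" n] by auto
      then show "1 / 2 \<le> dist (u m) (u n)" using u(3) by (simp add: dist_commute)
    qed simp
  qed
  have "?P (monom 1 n) \<in> V (Suc n)"
    unfolding V_def by (rule complex_vector.span_base) simp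
  then obtain q where q: "\<forall>k\<ge>n. coeff q k = 0" "?P (monom 1 n) = ?P q"
    using V_poly n by metis
  have "coeff (monom 1 n - q) n \<noteq> 0" using q by simp
  then have "monom 1 n - q \<noteq> 0" by (metis coeff_0)
  moreover have "?P (monom 1 n - q) = 0"
    using q yb by (simp add: poly_operator_diff compose_diff_right)
  ultimately obtain p where p: "p \<noteq> 0" "?P p = 0"
    and min: "\<And>q. q \<noteq> 0 \<Longrightarrow> ?P q = 0 \<Longrightarrow> degree p \<le> degree q"
    using ex_has_least_nat[of "\<lambda>p. p \<noteq> 0 \<and> ?P p = 0" "monom 1 n - q" degree] by blast
  have "degree p \<noteq> 0"
  proof
    assume "degree p = 0"
    then obtain a where a: "p = [:a:]" by (rule degree_eq_zeroE)
    then have "?P p = a *\<^sub>C y"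
      using compose_scaleC_right[OF yb, of a id_blinfun] by (simp add: poly_operator_pCons)
    then show False using p a y by simp
  qed
  then obtain c where "poly p c = 0"
    using fundamental_theorem_of_algebra[of p] by (auto simp: constant_degree)
  then obtain q where pq: "p = [:-c, 1:] * q" by (auto simp: poly_eq_0_iff_dvd dvd_def)
  then have "q \<noteq> 0" using p by auto
  then have "degree q < degree p" unfolding pq by (subst degree_mult_eq) auto
  define z where "z = ?P q"
  have "z \<noteq> 0" using min[of q] \<open>q \<noteq> 0\<close> \<open>degree q < degree p\<close> unfolding z_def by auto
  have zA: "z \<in> A" unfolding z_def by (rule compose_poly_operator_mem[OF y(1)])
  have yz: "y o\<^sub>L z = c *\<^sub>C z"
    using p(2) yb unfolding pq z_def
    by (simp only: poly_operator_linear_factor compose_diff_right compose_scaleC_right) simp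
  define d where "d = poly q c * c"
  have zz: "z o\<^sub>L z = d *\<^sub>C z"
    using poly_operator_eigenvector[OF yb yz, of q] yz yb
    by (subst (1) z_def) (simp add: compose_assoc compose_scaleC_right scaleC_scaleC d_def)
  have "d \<noteq> 0" using square_zero[OF ss zA] zz \<open>z \<noteq> 0\<close> by auto
  show thesis
  proof
    show "inverse d *\<^sub>C z \<in> A" using zA by (rule scaleC_mem)
    show "inverse d *\<^sub>C z \<noteq> 0" using \<open>z \<noteq> 0\<close> \<open>d \<noteq> 0\<close> by simp
    show "(inverse d *\<^sub>C z) o\<^sub>L (inverse d *\<^sub>C z) = inverse d *\<^sub>C z"
      using zz bounded[OF zA] \<open>d \<noteq> 0\<close>
      by (simp add: compose_scaleC_left compose_scaleC_right scaleC_scaleC)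
    show "c \<noteq> 0" using \<open>d \<noteq> 0\<close> by (simp add: d_def)
    show "y o\<^sub>L (inverse d *\<^sub>C z) = c *\<^sub>C inverse d *\<^sub>C z"
      using yz yb by (simp add: compose_scaleC_right scaleC_scaleC mult.commute)
  qed
qed

text \<open>The ideals \<open>f A\<close> of idempotents \<open>f = v f\<close> are closed and lie in the fixed space of \<open>v\<close>, so they
  satisfy the descending chain condition.  If \<open>f\<close> is minimal in this order and \<open>f a \<noteq> 0\<close>, then the
  idempotent \<open>g\<close> that \<open>eigenvector_idempotent\<close> finds for \<open>f a\<close> lies below \<open>f\<close>, so \<open>g = f\<close>, and the
  equation \<open>(f a) g = c g\<close> says that \<open>f a\<close> is a multiple of \<open>f\<close>.\<close>

lemma exists_minimal_idempotent_in_eigenspace: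
  assumes ss: "semisimple_algebra A" and C: "compact_algebra A" and v: "v \<in> A"
    and y: "y \<in> A" "y \<noteq> 0" "v o\<^sub>L y = y"
  obtains f where "minimal_idempotent A f" "v o\<^sub>L f = f"
proof -
  obtain K where K: "compact K" "\<And>b. b \<in> A \<Longrightarrow> norm b \<le> 1 \<Longrightarrow> v o\<^sub>L b \<in> K"
    using compact_multiplication[OF C v] by blast
  define E where "E = {f \<in> A. f \<noteq> 0 \<and> f o\<^sub>L f = f \<and> v o\<^sub>L f = f}"
  have factor: "\<exists>g\<in>E. \<exists>c. c \<noteq> 0 \<and> x o\<^sub>L g = c *\<^sub>C g" if x: "x \<in> A" "x \<noteq> 0" "v o\<^sub>L x = x" for x
  proof -
    obtain g c where g: "g \<in> A" "g \<noteq> 0" "g o\<^sub>L g = g" "c \<noteq> 0" "x o\<^sub>L g = c *\<^sub>C g"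
      using eigenvector_idempotent[OF ss C v x] by blast
    have "c *\<^sub>C (v o\<^sub>L g) = v o\<^sub>L (x o\<^sub>L g)"
      using g bounded[OF v] by (simp add: compose_scaleC_right)
    also have "\<dots> = c *\<^sub>C g" using x(3) g(5) by (metis compose_assoc)
    finally have "v o\<^sub>L g = g" using g(4) by simp
    with g show ?thesis unfolding E_def by blast
  qed
  obtain e where e: "e \<in> E" using factor[OF y] by blast
  have "\<exists>f\<in>E. \<forall>g\<in>E. f o\<^sub>L g = g \<longrightarrow> g = f"
  proof (rule ccontr)
    assume "\<not> ?thesis"
    then have "\<exists>g. g \<in> E \<and> f o\<^sub>L g = g \<and> g \<noteq> f" if "f \<in> E" for f using that by blast
    then obtain F where F: "\<And>n. F n \<in> E" "\<And>n::nat. F n o\<^sub>L F (Suc n) = F (Suc n) \<and> F (Suc n) \<noteq> F n"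
      using dependent_nat_choice[of "\<lambda>_ f. f \<in> E" "\<lambda>_ f g. f o\<^sub>L g = g \<and> g \<noteq> f"] e by metis
    have FE: "F n \<in> A" "F n o\<^sub>L F n = F n" "v o\<^sub>L F n = F n" for n
      using F(1)[of n] unfolding E_def by auto
    define U where "U n = {a \<in> A. F n o\<^sub>L a = a}" for n
    have U_sub: "subspace (U n)" for n
      by (rule complex_subspace_imp_subspace)
        (use subspace FE(1)[of n] in \<open>auto simp: U_def complex_vector.subspace_def
          compose_add_right compose_scaleC_right bounded\<close>)
    have U_closed: "closed (U n)" for n
    proof -
      have "closed {a :: 'h \<Rightarrow>\<^sub>L 'h. F n o\<^sub>L a = a}" by (intro closed_Collect_eq continuous_intros)
      moreover have "U n = A \<inter> {a. F n o\<^sub>L a = a}" unfolding U_def by blast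
      ultimately show ?thesis using closed by (simp add: closed_Int)
    qed
    have U_dec: "U (Suc n) \<subseteq> U n" for n
    proof
      fix a assume a: "a \<in> U (Suc n)"
      then have "F n o\<^sub>L a = (F n o\<^sub>L F (Suc n)) o\<^sub>L a" by (simp add: U_def compose_assoc)
      also have "\<dots> = a" using a F(2)[of n] by (simp add: U_def)
      finally show "a \<in> U n" using a by (simp add: U_def)
    qed
    have "U n \<noteq> U (Suc n)" for n
    proof
      assume "U n = U (Suc n)"
      moreover have "F n \<in> U n" using FE by (simp add: U_def)
      ultimately have "F (Suc n) o\<^sub>L F n = F n" by (simp add: U_def)
      then show False using F(2)[of n] commute[OF FE(1) FE(1)] by metis
    qed
    then have "\<exists>u. u \<in> U n \<and> norm u = 1 \<and> (\<forall>w\<in>U (Suc n). 1 / 2 \<le> dist u w)" for n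
      using riesz_unit_vector[OF U_sub U_sub U_closed U_dec] by metis
    then obtain x where x: "\<And>n. x n \<in> U n" "\<And>n. norm (x n) = 1"
      "\<And>n w. w \<in> U (Suc n) \<Longrightarrow> 1 / 2 \<le> dist (x n) w"
      by metis
    show False
    proof (rule compact_no_separated_sequence[OF K(1), of x "1/2"])
      show "x n \<in> K" for n
      proof -
        have xn: "x n \<in> A" "F n o\<^sub>L x n = x n" using x(1)[of n] by (auto simp: U_def)
        then have "v o\<^sub>L x n = x n" using FE(3)[of n] by (metis compose_assoc)
        then show ?thesis using K(2)[OF xn(1)] x(2)[of n] by simp
      qed
      fix m n :: nat assume "m < n"
      then have "U n \<subseteq> U (Suc m)" using U_dec lift_Suc_antimono_le[of U "Suc m" n] by simp
      then show "1 / 2 \<le> dist (x m) (x n)" using x by blast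
    qed simp
  qed
  then obtain f where "f \<in> E" and least: "\<And>g. g \<in> E \<Longrightarrow> f o\<^sub>L g = g \<Longrightarrow> g = f" by blast
  then have f: "f \<in> A" "f \<noteq> 0" "f o\<^sub>L f = f" "v o\<^sub>L f = f" unfolding E_def by auto
  have scalar: "\<exists>c. f o\<^sub>L a = c *\<^sub>C f" if a: "a \<in> A" for a
  proof (cases "f o\<^sub>L a = 0")
    case True
    then show ?thesis by (intro exI[of _ 0]) simp
  next
    case False
    have x: "f o\<^sub>L a \<in> A" "v o\<^sub>L (f o\<^sub>L a) = f o\<^sub>L a"
      using f a compose_mem by (auto simp flip: compose_assoc)
    then obtain g c where g: "g \<in> E" "c \<noteq> 0" "(f o\<^sub>L a) o\<^sub>L g = c *\<^sub>C g"
      using factor False by metis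
    have "c *\<^sub>C (f o\<^sub>L g) = f o\<^sub>L ((f o\<^sub>L a) o\<^sub>L g)"
      using g(3) bounded[OF f(1)] by (simp add: compose_scaleC_right)
    also have "\<dots> = c *\<^sub>C g" using f(3) g(3) by (metis compose_assoc)
    finally have "f o\<^sub>L g = g" using g(2) by simp
    then have "g = f" using least g(1) by blast
    moreover have "(f o\<^sub>L a) o\<^sub>L f = f o\<^sub>L a"
      using commute[OF x(1) f(1)] f(3) by (simp flip: compose_assoc)
    ultimately show ?thesis using g(3) by metis
  qed
  have "(\<lambda>a. f o\<^sub>L a) ` A = range (\<lambda>c. c *\<^sub>C f)"
  proof
    show "(\<lambda>a. f o\<^sub>L a) ` A \<subseteq> range (\<lambda>c. c *\<^sub>C f)" using scalar by blast
    have "c *\<^sub>C f = f o\<^sub>L (c *\<^sub>C f)" for c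
      using compose_scaleC_right[OF bounded[OF f(1)], of c f] f(3) by simp
    then show "range (\<lambda>c. c *\<^sub>C f) \<subseteq> (\<lambda>a. f o\<^sub>L a) ` A" using scaleC_mem[OF f(1)] by blast
  qed
  then show thesis using that f unfolding minimal_idempotent_def by blast
qed

lemma minimal_idempotents_separate:
  assumes ss: "semisimple_algebra A" and C: "compact_algebra A" and b: "b \<in> A" "b \<noteq> 0"
  obtains f where "minimal_idempotent A f" "f o\<^sub>L b \<noteq> 0"
proof -
  obtain c where c: "c \<in> A" "(\<lambda>a. a - ((b o\<^sub>L c) o\<^sub>L a)) ` A \<noteq> A"
    using modular_unit_in_principal_ideal[OF ss b] by blast
  have v: "b o\<^sub>L c \<in> A" using b c compose_mem by blast
  obtain y where "y \<in> A" "y \<noteq> 0" "(b o\<^sub>L c) o\<^sub>L y = y"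
    using compact_fredholm_alternative[OF C v c(2)] by blast
  then obtain f where f: "minimal_idempotent A f" "(b o\<^sub>L c) o\<^sub>L f = f"
    using exists_minimal_idempotent_in_eigenspace[OF ss C v] by metis
  have fA: "f \<in> A" "f \<noteq> 0" using f unfolding minimal_idempotent_def by auto
  have "f = f o\<^sub>L (b o\<^sub>L c)" using f(2) commute[OF v fA(1)] by simp
  then have "f = (f o\<^sub>L b) o\<^sub>L c" by (simp add: compose_assoc)
  then have "f o\<^sub>L b \<noteq> 0" using fA(2) by auto
  with f that show ?thesis by blast
qed

section \<open>The socle\<close>

lemma socle_subset: "socle A \<subseteq> A"
  unfolding socle_def
  by (rule complex_vector.span_minimal[OF _ subspace]) (auto simp: minimal_idempotent_def)

lemma socle_ideal:
  assumes a: "a \<in> A" and s: "s \<in> socle A"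
  shows "a o\<^sub>L s \<in> socle A"
  using s unfolding socle_def
proof (induction rule: complex_vector.span_induct_alt)
  case base
  show ?case by (simp add: complex_vector.span_zero)
next
  case (step c e x)
  then have e: "e \<in> A" "minimal_idempotent A e" by (auto simp: minimal_idempotent_def)
  then have "e o\<^sub>L a \<in> range (\<lambda>c. c *\<^sub>C e)" using a unfolding minimal_idempotent_def by blast
  then obtain d where "a o\<^sub>L e = d *\<^sub>C e" using commute[OF a e(1)] by auto
  then have "a o\<^sub>L (c *\<^sub>C e + x) = (c * d) *\<^sub>C e + (a o\<^sub>L x)"
    using bounded[OF a] by (simp add: compose_add_right compose_scaleC_right scaleC_scaleC)
  then show ?case
    using step.IH e(2) complex_vector.span_add complex_vector.span_scale complex_vector.span_base
    by (metis (no_types, lifting) mem_Collect_eq)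
qed

text \<open>The cluster point argument: the compactness hypothesis concerns the unit ball only, so \<open>a\<close> is
  rescaled by a bound \<open>N\<close> of the approximate identity.\<close>

lemma compact_imp_dense_socle:
  assumes ss: "semisimple_algebra A" and C: "compact_algebra A"
    and bai: "has_bounded_approximate_identity (socle A)"
  shows "closure (socle A) = A"
proof
  show "closure (socle A) \<subseteq> A" using closed socle_subset by (rule closure_minimal[rotated])
  obtain F M where "F \<noteq> bot" and FM: "eventually (\<lambda>e. e \<in> socle A \<and> norm e \<le> M) F"
    and unit: "\<And>s. s \<in> socle A \<Longrightarrow> ((\<lambda>e. e o\<^sub>L s) \<longlongrightarrow> s) F"
    using bai unfolding has_bounded_approximate_identity_def by blast
  define N where "N = max M 1"
  have N: "0 < N" by (simp add: N_def)
  show "A \<subseteq> closure (socle A)"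
  proof
    fix a assume a: "a \<in> A"
    obtain K where K: "compact K" "\<And>b. b \<in> A \<Longrightarrow> norm b \<le> 1 \<Longrightarrow> (N *\<^sub>R a) o\<^sub>L b \<in> K"
      using compact_multiplication[OF C scaleR_mem[OF a]] by blast
    have ev: "eventually (\<lambda>e. a o\<^sub>L e \<in> K \<inter> closure (socle A)) F"
      using FM
    proof eventually_elim
      case (elim e)
      then have e: "e \<in> A" "norm e \<le> N" using socle_subset by (auto simp: N_def)
      have "(N *\<^sub>R a) o\<^sub>L ((1 / N) *\<^sub>R e) = a o\<^sub>L e"
        using N by (intro blinfun_eqI) (simp add: blinfun.scaleR_left blinfun.scaleR_right)
      moreover have "(N *\<^sub>R a) o\<^sub>L ((1 / N) *\<^sub>R e) \<in> K"
        using e N by (intro K scaleR_mem) (auto simp: field_simps)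
      ultimately show ?case
        using socle_ideal[OF a, of e] elim closure_subset by auto
    qed
    have "compact (K \<inter> closure (socle A))" using K(1) by (simp add: compact_Int_closed)
    moreover have "filtermap (\<lambda>e. a o\<^sub>L e) F \<noteq> bot" using \<open>F \<noteq> bot\<close> by (simp add: filtermap_bot_iff)
    moreover have "eventually (\<lambda>x. x \<in> K \<inter> closure (socle A)) (filtermap (\<lambda>e. a o\<^sub>L e) F)"
      using ev by (simp add: eventually_filtermap)
    ultimately obtain l where l: "l \<in> closure (socle A)"
      and cluster: "inf (nhds l) (filtermap (\<lambda>e. a o\<^sub>L e) F) \<noteq> bot"
      unfolding compact_filter by blast
    \<comment> \<open>\<open>G\<close> plays the role of a subnet along which \<open>a e\<close> converges to \<open>l\<close>.\<close>
    define G where "G = inf (filtercomap (\<lambda>e. a o\<^sub>L e) (nhds l)) F"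
    have "G \<noteq> bot"
    proof
      assume "G = bot"
      then obtain P Q where P: "eventually P (nhds l)" and Q: "eventually Q F"
        and PQ: "\<And>e. P (a o\<^sub>L e) \<Longrightarrow> Q e \<Longrightarrow> False"
        unfolding G_def trivial_limit_def eventually_inf eventually_filtercomap by blast
      have "eventually (\<lambda>x. \<not> P x) (filtermap (\<lambda>e. a o\<^sub>L e) F)"
        unfolding eventually_filtermap using Q by eventually_elim (use PQ in blast)
      with P have "eventually (\<lambda>_. False) (inf (nhds l) (filtermap (\<lambda>e. a o\<^sub>L e) F))"
        unfolding eventually_inf by blast
      with cluster show False unfolding trivial_limit_def by blast
    qed
    have "filterlim (\<lambda>e. a o\<^sub>L e) (nhds l) (filtercomap (\<lambda>e. a o\<^sub>L e) (nhds l))"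
      by (rule filterlim_filtercomap)
    then have G_l: "((\<lambda>e. a o\<^sub>L e) \<longlongrightarrow> l) G" unfolding G_def
      by (rule filterlim_mono) auto
    have "G \<le> F" unfolding G_def by simp
    have lA: "l \<in> A" using l \<open>closure (socle A) \<subseteq> A\<close> by blast
    have "f o\<^sub>L (a - l) = 0" if f: "minimal_idempotent A f" for f
    proof -
      have fs: "f \<in> socle A" using f complex_vector.span_base unfolding socle_def by blast
      then have fA: "f \<in> A" using socle_subset by blast
      have 1: "((\<lambda>e. f o\<^sub>L (a o\<^sub>L e)) \<longlongrightarrow> f o\<^sub>L l) G" using G_l by (intro tendsto_intros)
      have "((\<lambda>e. a o\<^sub>L (e o\<^sub>L f)) \<longlongrightarrow> a o\<^sub>L f) F" using unit[OF fs] by (intro tendsto_intros)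
      then have "((\<lambda>e. a o\<^sub>L (e o\<^sub>L f)) \<longlongrightarrow> a o\<^sub>L f) G" by (rule tendsto_mono[OF \<open>G \<le> F\<close>])
      moreover have "eventually (\<lambda>e. a o\<^sub>L (e o\<^sub>L f) = f o\<^sub>L (a o\<^sub>L e)) G"
      proof (rule filter_leD[OF \<open>G \<le> F\<close>])
        show "eventually (\<lambda>e. a o\<^sub>L (e o\<^sub>L f) = f o\<^sub>L (a o\<^sub>L e)) F"
          using FM
        proof eventually_elim
          case (elim e)
          then have "a o\<^sub>L e \<in> A" using a socle_subset compose_mem by blast
          then show ?case using commute[OF _ fA] by (simp flip: compose_assoc)
        qed
      qed
      ultimately have "((\<lambda>e. f o\<^sub>L (a o\<^sub>L e)) \<longlongrightarrow> a o\<^sub>L f) G"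
        by (rule Lim_transform_eventually)
      then have "f o\<^sub>L l = a o\<^sub>L f" by (rule tendsto_unique[OF \<open>G \<noteq> bot\<close> 1])
      then show ?thesis using commute[OF a fA] by (simp add: compose_diff_right)
    qed
    then have "a - l = 0"
      using minimal_idempotents_separate[OF ss C diff_mem[OF a lA]] by metis
    then show "a \<in> closure (socle A)" using l by simp
  qed
qed

text \<open>For a minimal idempotent \<open>e\<close> and \<open>b\<close> in the unit ball, \<open>e b = d e\<close> with \<open>\<bar>d\<bar> \<le> 1\<close>, because
  \<open>\<parallel>e b\<parallel> \<le> \<parallel>e\<parallel>\<close>.  So the image of the unit ball under \<open>e\<close> lies in a disc in the line spanned by
  \<open>e\<close>, and finite sums of compact sets are compact.\<close>

lemma socle_multiplication_compact:
  assumes s: "s \<in> socle A"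
  shows "\<exists>K. compact K \<and> (\<lambda>b. s o\<^sub>L b) ` {b \<in> A. norm b \<le> 1} \<subseteq> K"
  using s unfolding socle_def
proof (induction rule: complex_vector.span_induct_alt)
  case base
  show ?case by (rule exI[of _ "{0}"]) auto
next
  case (step c e x)
  then obtain K where K: "compact K" "(\<lambda>b. x o\<^sub>L b) ` {b \<in> A. norm b \<le> 1} \<subseteq> K" by blast
  have e: "e \<noteq> 0" "(\<lambda>a. e o\<^sub>L a) ` A = range (\<lambda>c. c *\<^sub>C e)"
    using step(1) by (auto simp: minimal_idempotent_def)
  have "compact ((\<lambda>d. d *\<^sub>C c *\<^sub>C e) ` cball 0 1)"
  proof (rule compact_continuous_image)
    show "continuous_on (cball 0 1) (\<lambda>d. d *\<^sub>C c *\<^sub>C e)"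
      by (rule linear_continuous_on[OF bounded_linear_scaleC_left])
  qed simp
  then have "compact {x + y |x y. x \<in> (\<lambda>d. d *\<^sub>C c *\<^sub>C e) ` cball 0 1 \<and> y \<in> K}"
    using K(1) by (rule compact_sums)
  moreover have "(c *\<^sub>C e + x) o\<^sub>L b \<in> {x + y |x y. x \<in> (\<lambda>d. d *\<^sub>C c *\<^sub>C e) ` cball 0 1 \<and> y \<in> K}"
    if b: "b \<in> A" "norm b \<le> 1" for b
  proof -
    obtain d where d: "e o\<^sub>L b = d *\<^sub>C e" using e(2) b by blast
    have "cmod d * norm e \<le> norm e * norm b"
      using norm_blinfun_compose[of e b] unfolding d norm_scaleC .
    also have "\<dots> \<le> norm e * 1" using b(2) by (intro mult_left_mono) auto
    finally have "d \<in> cball 0 1" using e(1) by simp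
    moreover have "(c *\<^sub>C e + x) o\<^sub>L b = d *\<^sub>C c *\<^sub>C e + (x o\<^sub>L b)"
      by (simp add: compose_add_left compose_scaleC_left d scaleC_scaleC mult.commute)
    ultimately show ?thesis using K(2) b by blast
  qed
  ultimately show ?case by blast
qed

text \<open>If \<open>s\<close> is close to \<open>a\<close> in norm, then \<open>s b\<close> is uniformly close to \<open>a b\<close> on the unit ball, so the
  image under \<open>a\<close> inherits total boundedness from the images under elements of the socle.\<close>

lemma dense_socle_imp_compact:
  assumes dense: "closure (socle A) = A"
  shows "compact_algebra A"
  unfolding compact_algebra_def
proof
  fix a assume a: "a \<in> A"
  let ?B = "{b \<in> A. norm b \<le> 1}"
  have "\<exists>T. finite T \<and> closure ((\<lambda>b. a o\<^sub>L b) ` ?B) \<subseteq> (\<Union>x\<in>T. ball x r)" if r: "0 < r" for r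
  proof -
    obtain s where s: "s \<in> socle A" "dist s a < r / 3"
      using a dense closure_approachable[of a "socle A"] r by (metis zero_less_divide_iff zero_less_numeral)
    obtain K where K: "compact K" "(\<lambda>b. s o\<^sub>L b) ` ?B \<subseteq> K"
      using socle_multiplication_compact[OF s(1)] by blast
    then obtain T where T: "finite T" "K \<subseteq> (\<Union>x\<in>T. ball x (r / 3))"
      using r unfolding compact_eq_totally_bounded by (metis zero_less_divide_iff zero_less_numeral)
    have "closure ((\<lambda>b. a o\<^sub>L b) ` ?B) \<subseteq> (\<Union>x\<in>T. ball x r)"
    proof
      fix z assume "z \<in> closure ((\<lambda>b. a o\<^sub>L b) ` ?B)"
      then obtain b where b: "b \<in> A" "norm b \<le> 1" "dist (a o\<^sub>L b) z < r / 3"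
        using closure_approachable[of z] r by (fastforce dest: spec[of _ "r / 3"])
      have "s o\<^sub>L b \<in> K" using K(2) b by blast
      then obtain x where x: "x \<in> T" "dist x (s o\<^sub>L b) < r / 3" using T by auto
      have "dist (s o\<^sub>L b) (a o\<^sub>L b) \<le> dist s a * norm b"
        using norm_blinfun_compose[of "s - a" b] by (simp add: dist_norm compose_diff_left)
      also have "\<dots> \<le> dist s a * 1" using b(2) by (intro mult_left_mono) auto
      finally have "dist x z < r"
        using x(2) b(3) s(2) dist_triangle[of x z "s o\<^sub>L b"] dist_triangle[of "s o\<^sub>L b" z "a o\<^sub>L b"]
        by linarith
      then show "z \<in> (\<Union>x\<in>T. ball x r)" using x(1) by auto
    qed
    with T(1) show ?thesis by blast
  qed
  then show "compact (closure ((\<lambda>b. a o\<^sub>L b) ` ?B))"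
    unfolding compact_eq_totally_bounded by (simp add: complete_eq_closed)
qed

end

theorem corollary1p6:
  fixes A :: "('h::complex_hilbert_space \<Rightarrow>\<^sub>L 'h) set"
  assumes "operator_algebra A"
    and "semisimple_algebra A"
    and "topologically_singly_generated A"
    and "has_bounded_approximate_identity (socle A)"
  shows "closure (socle A) = A \<longleftrightarrow> compact_algebra A"
proof -
  interpret commutative_operator_algebra A
    using assms(1) topologically_singly_generated_commute[OF assms(1,3)] by unfold_locales
  show ?thesis using dense_socle_imp_compact compact_imp_dense_socle[OF assms(2) _ assms(4)] by blast
qed

end
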